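(* Every lattice satisfying $(\mathrm{SD}_{\vee}^{\omega})$ is dually staircase distributive.
   Context: For a set $X$, $X^{<\omega}$ is the set of finite sequences of elements of $X$, $|\boldsymbol{s}|$ is the length of $\boldsymbol{s}$, and ${}^\frown$ is concatenation. For a lattice $L$, let $L\cup\{1\}$ be $L$ with a new largest element $1$ added. For $a\in L$ and $\boldsymbol{t}\in L^{<\omega}$ define $a*\boldsymbol{t}\in L\cup\{1\}$ by $a*\varnothing=1$ and $a*(\boldsymbol{t}^\frown\langle b\rangle)=a\vee(b\wedge(a*\boldsymbol{t}))$; for $B\subseteq L$ put $a*B=\{a*\boldsymbol{t}\mid\boldsymbol{t}\in B^{<\omega}\}$. For $\boldsymbol{s}\in L^{<\omega}$ and $x\in L\cup\{1\}$ define $\boldsymbol{s}\mathbin{\lozenge}x$ by $\varnothing\mathbin{\lozenge}x=x$ and $$(\boldsymbol{s}^\frown\langle a\rangle)\mathbin{\lozenge}x=\begin{cases}a\vee(\boldsymbol{s}\mathbin{\lozenge}x)&\text{if }|\boldsymbol{s}|\text{ is even},\\ a\wedge(\boldsymbol{s}\mathbin{\lozenge}x)&\text{if }|\boldsymbol{s}|\text{ is odd}.\end{cases}$$ $L$ satisfies $(\mathrm{SD}_{\vee}^{\omega})$ if for all $\boldsymbol{s}\in L^{<\omega}$ and all $a,b,c\in L$, $$\boldsymbol{s}\mathbin{\lozenge}(a\vee(b\wedge c))=\bigwedge\{\boldsymbol{s}\mathbin{\lozenge}(a*\boldsymbol{t})\mid\boldsymbol{t}\in\{b,c\}^{<\omega}\},$$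 meaning that the right-hand side meet exists and equals the left-hand side. $L$ is dually staircase distributive if for every positive integer $n$ it is dually $n$-$*$-distributive, i.e. for all $a\in L$ and all $B\subseteq L$ with at most $n$ elements such that $\bigwedge B$ exists, the meet $\bigwedge(a*B)$ (greatest element of $L$ below all elements of $a*B$) exists and equals $a\vee\bigwedge B$. *)

theory Defs
  imports "HOL-Library.Lattice_Constructions" "HOL-Library.Lub_Glb"
begin

text \<open>
  A lattice \<open>L\<close> is a type of class \<open>lattice\<close>, and \<open>L \<union> {1}\<close> is the type \<open>'a top\<close> of
  Lattice_Constructions: \<open>top.Value\<close> embeds \<open>L\<close> and \<open>top.Top\<close> is the new largest element \<open>1\<close>,
  which is new even if \<open>L\<close> already has a largest element. Finite sequences over \<open>B\<close> are
  \<open>lists B\<close>; the last entry of a list is the one appended last, and acts outermost.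
\<close>

context
  includes lattice_syntax
begin

definition star :: "'a::lattice \<Rightarrow> 'a list \<Rightarrow> 'a top" where
  "star a t = fold (\<lambda>b x. top.Value a \<squnion> (top.Value b \<sqinter> x)) t top.Top"

lemma star_Nil: "star a [] = top.Top"
  by (simp add: star_def)

lemma star_snoc: "star a (t @ [b]) = top.Value a \<squnion> (top.Value b \<sqinter> star a t)"
  by (simp add: star_def)

definition star_set :: "'a::lattice \<Rightarrow> 'a set \<Rightarrow> 'a top set" where
  "star_set a B = star a ` lists B"

definition lozenge :: "'a::lattice list \<Rightarrow> 'a top \<Rightarrow> 'a top" where
  "lozenge s x =
    fold (\<lambda>(i, a) y. if even i then top.Value a \<squnion> y else top.Value a \<sqinter> y) (enumerate 0 s) x"

lemma lozenge_Nil: "lozenge [] x = x"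
  by (simp add: lozenge_def)

lemma lozenge_snoc:
  "lozenge (s @ [a]) x =
    (if even (length s) then top.Value a \<squnion> lozenge s x else top.Value a \<sqinter> lozenge s x)"
  by (simp add: lozenge_def enumerate_append_eq)

text \<open>
  Meets of subsets of \<open>L \<union> {1}\<close> are taken in \<open>L\<close>: \<open>m\<close> is the meet of \<open>S\<close> if it is the greatest
  element of \<open>L\<close> below all elements of \<open>S\<close>. Except for \<open>S \<subseteq> {1}\<close>, this is the same as
  being the greatest lower bound in \<open>L \<union> {1}\<close>; the sets in \<open>SD_join_omega\<close> always contain
  the element \<open>s \<lozenge> (a \<or> b)\<close> of \<open>L\<close>, given by \<open>t = [b]\<close>.
\<close>

definition is_meet :: "'a::lattice top set \<Rightarrow> 'a top \<Rightarrow> bool" where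
  "is_meet S m \<longleftrightarrow> isGlb (range top.Value) S m"

definition SD_join_omega :: "'a::lattice itself \<Rightarrow> bool" where
  "SD_join_omega _ \<longleftrightarrow>
    (\<forall>(s :: 'a list) (a :: 'a) (b :: 'a) (c :: 'a).
      is_meet {lozenge s (star a t) | t. t \<in> lists {b, c}}
        (lozenge s (top.Value (a \<squnion> (b \<sqinter> c)))))"

text \<open>
  \<open>B\<close> may be empty: its meet exists iff \<open>L\<close> has a largest element.
\<close>

definition dually_star_distributive :: "'a::lattice itself \<Rightarrow> nat \<Rightarrow> bool" where
  "dually_star_distributive _ n \<longleftrightarrow>
    (\<forall>(a :: 'a) (B :: 'a set) (m :: 'a).
      finite B \<and> card B \<le> n \<and> isGlb UNIV B m \<longrightarrow> is_meet (star_set a B) (top.Value (a \<squnion> m)))"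

definition dually_staircase_distributive :: "'a::lattice itself \<Rightarrow> bool" where
  "dually_staircase_distributive L \<longleftrightarrow> (\<forall>n>0. dually_star_distributive L n)"

end

end

theory Submission
  imports Defs
begin

text \<open>
  Fix \<open>a\<close> and a finite nonempty \<open>B\<close>. The finite values of \<open>a * t\<close>, for \<open>t\<close> over \<open>B\<close>, form a
  down-directed set \<open>Q\<close>, whose formal meet \<open>q\<close> (in the filter lattice) satisfies
  \<open>q = a \<or> (b \<and> q)\<close> for all \<open>b \<in> B\<close>. By \<open>(SD\<^sub>\<or>\<^sup>\<omega>)\<close>, elements of \<open>L\<close> cannot tell \<open>a \<or> (c \<and> d)\<close> from
  the formal meet of the \<open>a * t\<close> with \<open>t\<close> over \<open>{c, d}\<close>, even inside a polynomial \<open>s \<lozenge> _\<close>;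
  so the elements \<open>e\<close> with \<open>q = a \<or> (e \<and> q)\<close> are closed under meets, as under ordinary join
  semidistributivity. Hence \<open>q = a \<or> (\<And>B \<and> q)\<close>, which lies below \<open>a \<or> \<And>B\<close>.
\<close>

context
  includes lattice_syntax
begin

lemma sup_Value: "top.Value a \<squnion> top.Value b = top.Value (a \<squnion> b)"
  by (simp add: sup_top_def)

lemma inf_Value: "top.Value a \<sqinter> top.Value b = top.Value (a \<sqinter> b)"
  by (simp add: inf_top_def)

lemma Value_le_star: "top.Value a \<le> star a t"
  by (induction t rule: rev_induct) (simp_all add: star_Nil star_snoc)

lemma sup_star [simp]: "top.Value a \<squnion> star a t = star a t"
  by (simp add: sup_absorb2 Value_le_star)

text \<open>Since \<open>a\<close> lies below each value \<open>x\<close> of \<open>star a\<close>,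
  the next value \<open>a \<squnion> (b \<sqinter> x)\<close> is again below
  \<open>x\<close>.\<close>

lemma star_append_le_left: "star a (t @ u) \<le> star a t"
proof (induction u rule: rev_induct)
  case (snoc b u)
  have "star a (t @ u @ [b]) \<le> star a (t @ u)"
    by (simp add: star_snoc Value_le_star flip: append_assoc)
  with snoc show ?case
    by simp
qed simp

text \<open>A prefix only lowers the starting value \<open>1\<close>, and each later letter acts
  monotonically.\<close>

lemma star_append_le_right: "star a (t @ u) \<le> star a u"
proof (induction u rule: rev_induct)
  case Nil
  show ?case
    by (simp add: star_Nil)
next
  case (snoc b u)
  have "star a ((t @ u) @ [b]) \<le> star a (u @ [b])"
    unfolding star_snoc by (intro sup_mono inf_mono order_refl snoc)
  then show ?case
    by simp
qed

lemma star_eq_Value: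
  assumes "t \<noteq> []"
  obtains q where "star a t = top.Value q"
  using assms
  by (cases t rule: rev_cases; cases "star a (butlast t)")
    (auto simp: star_snoc sup_top_def inf_top_def)

lemma lozenge_mono: "x \<le> y \<Longrightarrow> lozenge s x \<le> lozenge s y"
proof (induction s rule: rev_induct)
  case (snoc a s)
  then show ?case
    by (auto simp: lozenge_snoc intro: le_supI2 le_infI2)
qed (simp add: lozenge_Nil)

lemma lozenge_append_even:
  "even (length r) \<Longrightarrow> lozenge (r @ s) x = lozenge s (lozenge r x)"
  by (induction s rule: rev_induct)
    (simp_all add: lozenge_Nil lozenge_snoc flip: append_assoc)

text \<open>
  The outermost meet with \<open>a \<squnion> c\<close> has no effect; it makes the length of the prefix even.
\<close>

lemma lozenge_prefix:
  "lozenge ([a, c, a, a \<squnion> c] @ s) x =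
    lozenge s (top.Value a \<squnion> (top.Value c \<sqinter> (top.Value a \<squnion> x)))"
proof -
  let ?y = "top.Value a \<squnion> (top.Value c \<sqinter> (top.Value a \<squnion> x))"
  have "?y \<le> top.Value (a \<squnion> c)"
    by (auto simp flip: sup_Value intro: le_infI1)
  then have "lozenge [a, c, a, a \<squnion> c] x = ?y"
    by (simp add: lozenge_def inf_absorb2)
  then show ?thesis
    by (subst lozenge_append_even) simp_all
qed

text \<open>
  The elements \<open>e\<close> with \<open>q = a \<squnion> (e \<sqinter> q)\<close> for the formal meet \<open>q\<close> of \<open>Q\<close>, as far as
  this is visible to inequalities \<open>y \<le> s \<lozenge> _\<close> over \<open>L\<close>.
\<close>

definition absorbed :: "'a::lattice \<Rightarrow> 'a set \<Rightarrow> 'a set" where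
  "absorbed a Q = {e. \<forall>s y. (\<forall>q\<in>Q. top.Value y \<le> lozenge s (top.Value q)) \<longrightarrow>
    (\<forall>q\<in>Q. top.Value y \<le> lozenge s (top.Value (a \<squnion> (e \<sqinter> q))))}"

lemma absorbedD:
  assumes "e \<in> absorbed a Q" "q \<in> Q"
    and "\<And>q. q \<in> Q \<Longrightarrow> top.Value y \<le> lozenge s (top.Value q)"
  shows "top.Value y \<le> lozenge s (top.Value (a \<squnion> (e \<sqinter> q)))"
  using assms by (auto simp: absorbed_def)

text \<open>\<open>SD\<close> reduces the claim to bounding \<open>lozenge s (star a t)\<close> for
  all \<open>t\<close> over \<open>{e \<sqinter> q, d \<sqinter> q}\<close>. The letters of
  \<open>t\<close> are moved from its end into the polynomial one by one, so the induction must
  range over all \<open>s\<close>, as \<open>absorbed\<close> does.\<close>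

lemma absorbed_inf:
  fixes a :: "'a::lattice"
  assumes SD: "SD_join_omega TYPE('a)"
    and directed: "\<And>p q. p \<in> Q \<Longrightarrow> q \<in> Q \<Longrightarrow> \<exists>r\<in>Q. r \<le> p \<and> r \<le> q"
    and e: "e \<in> absorbed a Q" and d: "d \<in> absorbed a Q"
  shows "e \<sqinter> d \<in> absorbed a Q"
  unfolding absorbed_def mem_Collect_eq
proof (intro allI impI ballI)
  fix s y q
  assume y: "\<forall>q\<in>Q. top.Value y \<le> lozenge s (top.Value q)" and q: "q \<in> Q"
  have le_star: "top.Value y \<le> lozenge s (star a t)"
    if "t \<in> lists {e \<sqinter> q, d \<sqinter> q}" and "\<forall>p\<in>Q. top.Value y \<le> lozenge s (top.Value p)" for t s
    using that
  proof (induction t arbitrary: s rule: rev_induct)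
    case Nil
    then have "top.Value y \<le> lozenge s (top.Value q)"
      using q by blast
    also have "\<dots> \<le> lozenge s (star a [])"
      by (rule lozenge_mono) (simp add: star_Nil)
    finally show ?case .
  next
    case (snoc c t)
    then obtain f where f: "f \<in> absorbed a Q" and c: "c = f \<sqinter> q"
      using e d by auto
    \<comment> \<open>At \<open>star a t\<close> this longer polynomial takes the value
      \<open>lozenge s (star a (t @ [c]))\<close>, so the induction hypothesis for it gives the
      goal.\<close>
    have "\<forall>p\<in>Q. top.Value y \<le> lozenge ([a, c, a, a \<squnion> c] @ s) (top.Value p)"
    proof
      fix p
      assume "p \<in> Q"
      \<comment> \<open>Here \<open>r \<le> q\<close> puts \<open>f \<sqinter> r\<close> below
        \<open>c\<close>, and \<open>r \<le> p\<close> puts it below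
        \<open>a \<squnion> p\<close>.\<close>
      then obtain r where r: "r \<in> Q" "r \<le> p" "r \<le> q"
        using directed q by blast
      have "top.Value y \<le> lozenge s (top.Value (a \<squnion> (f \<sqinter> r)))"
        using f r(1) snoc.prems(2) by (intro absorbedD) auto
      also have "a \<squnion> (f \<sqinter> r) \<le> a \<squnion> (c \<sqinter> (a \<squnion> p))"
        unfolding c using r by (intro sup_mono) (auto intro: le_infI1 le_infI2 le_supI2)
      then have "lozenge s (top.Value (a \<squnion> (f \<sqinter> r))) \<le>
          lozenge s (top.Value (a \<squnion> (c \<sqinter> (a \<squnion> p))))"
        by (intro lozenge_mono) simp
      finally show "top.Value y \<le> lozenge ([a, c, a, a \<squnion> c] @ s) (top.Value p)"
        unfolding lozenge_prefix by (simp add: sup_Value inf_Value)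
    qed
    moreover have "t \<in> lists {e \<sqinter> q, d \<sqinter> q}"
      using snoc.prems(1) by simp
    ultimately have "top.Value y \<le> lozenge ([a, c, a, a \<squnion> c] @ s) (star a t)"
      by (intro snoc.IH)
    then show ?case
      unfolding lozenge_prefix by (simp add: star_snoc)
  qed
  have "is_meet {lozenge s (star a t) |t. t \<in> lists {e \<sqinter> q, d \<sqinter> q}}
      (lozenge s (top.Value (a \<squnion> ((e \<sqinter> q) \<sqinter> (d \<sqinter> q)))))"
    using SD by (simp only: SD_join_omega_def)
  moreover have "isLb (range top.Value) {lozenge s (star a t) |t. t \<in> lists {e \<sqinter> q, d \<sqinter> q}}
      (top.Value y)"
    using le_star y by (auto intro!: isLbI setgeI)
  ultimately have "top.Value y \<le> lozenge s (top.Value (a \<squnion> ((e \<sqinter> q) \<sqinter> (d \<sqinter> q))))"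
    unfolding is_meet_def by (rule isGlb_le_isLb)
  also have "(e \<sqinter> q) \<sqinter> (d \<sqinter> q) = e \<sqinter> d \<sqinter> q"
    by (simp add: inf.commute inf.left_commute)
  finally show "top.Value y \<le> lozenge s (top.Value (a \<squnion> (e \<sqinter> d \<sqinter> q)))" .
qed

lemma Inf_fin_in_absorbed:
  fixes a :: "'a::lattice"
  assumes "SD_join_omega TYPE('a)"
    and "\<And>p q. p \<in> Q \<Longrightarrow> q \<in> Q \<Longrightarrow> \<exists>r\<in>Q. r \<le> p \<and> r \<le> q"
    and "finite B" "B \<noteq> {}" "B \<subseteq> absorbed a Q"
  shows "\<Sqinter>\<^sub>f\<^sub>i\<^sub>n B \<in> absorbed a Q"
  using assms(3-5)
proof (induction B rule: finite_ne_induct)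
  case (insert b B)
  then show ?case
    using absorbed_inf[OF assms(1,2)] by simp
qed simp

text \<open>Concatenating sequences with values \<open>p\<close> and \<open>q\<close> gives a value
  below both.\<close>

lemma star_values_directed:
  assumes "top.Value p \<in> star_set a B" "top.Value q \<in> star_set a B"
  shows "\<exists>r. top.Value r \<in> star_set a B \<and> r \<le> p \<and> r \<le> q"
proof -
  obtain t u where tu: "t \<in> lists B" "u \<in> lists B"
    and p: "star a t = top.Value p" and q: "star a u = top.Value q"
    using assms by (metis imageE star_set_def)
  have "t @ u \<noteq> []"
    using p by (auto simp: star_Nil)
  then obtain r where r: "star a (t @ u) = top.Value r"
    by (rule star_eq_Value)
  have "top.Value r \<in> star_set a B"
    using tu by (auto simp: star_set_def r intro!: image_eqI[where x = "t @ u"])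
  with star_append_le_left[of a t u] star_append_le_right[of a t u] show ?thesis
    by (auto simp: r p q)
qed

text \<open>Appending \<open>b\<close> turns a value \<open>q\<close> into
  \<open>a \<squnion> (b \<sqinter> q)\<close>, which is therefore again in the set.\<close>

lemma generators_absorbed:
  "B \<subseteq> absorbed a {q. top.Value q \<in> star_set a B}"
proof
  fix b
  assume b: "b \<in> B"
  have "top.Value (a \<squnion> (b \<sqinter> q)) \<in> star_set a B" if "top.Value q \<in> star_set a B" for q
  proof -
    obtain t where t: "t \<in> lists B" "star a t = top.Value q"
      using \<open>top.Value q \<in> star_set a B\<close> by (metis imageE star_set_def)
    then have "star a (t @ [b]) = top.Value (a \<squnion> (b \<sqinter> q))"
      by (simp add: star_snoc sup_top_def inf_top_def)
    moreover have "t @ [b] \<in> lists B"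
      using t b by simp
    ultimately show ?thesis
      unfolding star_set_def by (metis image_eqI)
  qed
  then show "b \<in> absorbed a {q. top.Value q \<in> star_set a B}"
    by (simp add: absorbed_def)
qed

lemma sup_lower_bound_le_star:
  assumes "t \<in> lists B" "\<And>b. b \<in> B \<Longrightarrow> m \<le> b"
  shows "top.Value (a \<squnion> m) \<le> star a t"
  using assms(1)
proof (induction t rule: rev_induct)
  case (snoc b t)
  then have "top.Value m \<le> star a t"
    by (auto simp flip: sup_Value)
  moreover have "top.Value m \<le> top.Value b"
    using snoc.prems assms(2) by simp
  ultimately have "top.Value a \<squnion> top.Value m \<le> star a (t @ [b])"
    unfolding star_snoc by (intro sup_mono) simp_all
  then show ?case
    by (simp add: sup_Value)
qed (simp add: star_Nil)

text \<open>This is the half of the theorem that rests on \<open>SD\<close>: absorption of the meet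
  of \<open>B\<close> is read off with the empty polynomial.\<close>

lemma SD_join_omega_lower_bound_le:
  fixes a :: "'a::lattice"
  assumes SD: "SD_join_omega TYPE('a)" and "finite B" and m: "isGlb UNIV B m"
    and y: "\<And>x. x \<in> star_set a B \<Longrightarrow> top.Value y \<le> x"
  shows "y \<le> a \<squnion> m"
proof (cases "B = {}")
  case True
  \<comment> \<open>The meet of the empty set is the greatest element.\<close>
  then have "y \<le> m"
    using m by (auto intro: isGlb_le_isLb isLbI setgeI)
  then show ?thesis
    by (rule le_supI2)
next
  case False
  define Q where "Q = {q. top.Value q \<in> star_set a B}"
  obtain b where b: "b \<in> B"
    using False by blast
  \<comment> \<open>The one-letter sequence supplies an element of \<open>Q\<close> at which to
    evaluate absorption.\<close>
  have "star a [b] = top.Value (a \<squnion> b)"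
    using star_snoc[of a "[]" b] by (simp add: star_Nil sup_top_def inf_top_def)
  then have ab: "a \<squnion> b \<in> Q"
    using b by (auto simp: Q_def star_set_def intro!: image_eqI[where x = "[b]"])
  have "\<Sqinter>\<^sub>f\<^sub>i\<^sub>n B \<in> absorbed a Q"
    using SD \<open>finite B\<close> False generators_absorbed[of B a] star_values_directed[of _ a B]
    by (intro Inf_fin_in_absorbed) (auto simp: Q_def)
  then have "top.Value y \<le> lozenge [] (top.Value (a \<squnion> (\<Sqinter>\<^sub>f\<^sub>i\<^sub>n B \<sqinter> (a \<squnion> b))))"
    using ab y by (intro absorbedD) (auto simp: Q_def lozenge_Nil dest: y)
  then have "y \<le> a \<squnion> (\<Sqinter>\<^sub>f\<^sub>i\<^sub>n B \<sqinter> (a \<squnion> b))"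
    by (simp add: lozenge_Nil)
  moreover have "\<Sqinter>\<^sub>f\<^sub>i\<^sub>n B \<le> m"
    using m \<open>finite B\<close> by (auto intro!: isGlb_le_isLb[OF m] isLbI setgeI Inf_fin.coboundedI)
  ultimately show ?thesis
    by (meson inf.coboundedI1 order_refl order_trans sup_mono)
qed

end

theorem corollary11p3:
  assumes "SD_join_omega TYPE('a::lattice)"
  shows "dually_staircase_distributive TYPE('a)"
  unfolding dually_staircase_distributive_def dually_star_distributive_def
proof (intro allI impI)
  fix n :: nat and a m :: 'a and B
  assume B: "finite B \<and> card B \<le> n \<and> isGlb UNIV B m"
  then have "m \<le> b" if "b \<in> B" for b
    using that by (metis isGlbD2)
  then have "isLb (range top.Value) (star_set a B) (top.Value (sup a m))"
    using sup_lower_bound_le_star[of _ B m a] by (auto simp: star_set_def intro!: isLbI setgeI)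
  moreover have "z \<le> top.Value (sup a m)" if z: "isLb (range top.Value) (star_set a B) z" for z
  proof -
    obtain y where "z = top.Value y"
      using isLbD2a[OF z] by blast
    then show ?thesis
      using SD_join_omega_lower_bound_le[OF assms, of B m a y] B isLbD[OF z]
      by simp
  qed
  ultimately show "is_meet (star_set a B) (top.Value (sup a m))"
    unfolding is_meet_def by (auto intro!: isGlbI2 setleI)
qed

end
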